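(* For every $\bm{\kappa}\in[0,1]^N$, $\mathcal{X}_{\mathrm{LA}}(\bm{\kappa})=\mathcal{X}_{\mathrm{SLA}}(\bm{\kappa})$.
   Context: Data: positive integers $L,K,N,P$; $[n]:=\{1,\dots,n\}$; $\mathcal{X}\subseteq\mathbb{R}^L$ a compact polyhedron; risk tolerance $\epsilon\in(0,1)$; Wasserstein radius $\theta>0$; samples $\bm{\xi}_1,\dots,\bm{\xi}_N\in\mathbb{R}^K$; for each $p\in[P]$, $\bm{a}_p\in\mathbb{R}^L$, $\bm{b}_p\in\mathbb{R}^K$ with $\bm{b}_p\neq\bm{0}$, and $d_p\in\mathbb{R}$. $\|\cdot\|$ is a norm on $\mathbb{R}^K$ and $\|\cdot\|_*$ its dual norm. Let $k:=\lfloor\epsilon N\rfloor$, and for each $p\in[P]$ let $q_p$ be the $(k+1)$-th smallest value (counted with multiplicity) among $\bm{b}_p^\top\bm{\xi}_1,\dots,\bm{b}_p^\top\bm{\xi}_N$. The slope parameter vector is $\bm{\kappa}\in[0,1]^N$. $\mathcal{X}_{\mathrm{LA}}(\bm{\kappa})$ (Linear Approximation) is the set of $\bm{x}\in\mathcal{X}$ for which there exist $s\in\mathbb{R}$, $\bm{r}\in\mathbb{R}^N$ with $s\ge0$, $\bm{r}\ge\bm{0}$, $\epsilon N s-\sum_{i\in[N]}r_i\ge\theta N$, and $\kappa_i\frac{\bm{b}_p^\top\bm{\xi}_i+d_p-\bm{a}_p^\top\bm{x}}{\|\bm{b}_p\|_*}\ge s-r_i$ for all $i\in[N]$, $p\in[P]$.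 $\mathcal{X}_{\mathrm{SLA}}(\bm{\kappa})$ (Strengthened Linear Approximation) is the set of $\bm{x}\in\mathcal{X}$ for which there exist $s\in\mathbb{R}$, $\bm{r}\in\mathbb{R}^N$ satisfying all of the constraints just listed for $\mathcal{X}_{\mathrm{LA}}(\bm{\kappa})$ and, in addition, $\frac{q_p+d_p-\bm{a}_p^\top\bm{x}}{\|\bm{b}_p\|_*}\ge s$ for all $p\in[P]$. *)

theory Defs
  imports "HOL-Analysis.Analysis"
begin

text \<open>
  The library fixes one norm per type (Euclidean on \<open>real ^ 'k\<close>), so an arbitrary norm on
  \<open>\<real>\<^sup>K\<close> is a function satisfying the norm axioms.
\<close>

definition is_norm :: "('a::real_vector \<Rightarrow> real) \<Rightarrow> bool" where
  "is_norm nrm \<longleftrightarrow>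
     (\<forall>x. 0 \<le> nrm x) \<and>
     (\<forall>x. nrm x = 0 \<longleftrightarrow> x = 0) \<and>
     (\<forall>c x. nrm (c *\<^sub>R x) = \<bar>c\<bar> * nrm x) \<and>
     (\<forall>x y. nrm (x + y) \<le> nrm x + nrm y)"

definition dual_norm :: "('a::euclidean_space \<Rightarrow> real) \<Rightarrow> 'a \<Rightarrow> real" where
  "dual_norm nrm y = (SUP x\<in>{x. nrm x \<le> 1}. y \<bullet> x)"

text \<open>
  List indexing starts at \<open>0\<close>, so entry \<open>k\<close> of the sorted list is the \<open>(k+1)\<close>-th smallest value,
  counted with multiplicity. For \<open>\<epsilon> < 1\<close> and \<open>N > 0\<close> the index is less than \<open>N\<close>.
\<close>

definition scenario_quantile ::
    "real \<Rightarrow> nat \<Rightarrow> (nat \<Rightarrow> 'k::real_inner) \<Rightarrow> 'k \<Rightarrow> real" where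
  "scenario_quantile \<epsilon> N \<xi> b =
     sort (map (\<lambda>i. b \<bullet> \<xi> i) [1..<N+1]) ! nat \<lfloor>\<epsilon> * real N\<rfloor>"

text \<open>
  Vectors indexed by \<open>{1..N}\<close> or \<open>{1..P}\<close> are functions on \<open>nat\<close>; only their values on these
  index sets matter.
\<close>

definition LA_constraints ::
    "real \<Rightarrow> real \<Rightarrow> ('k::euclidean_space \<Rightarrow> real) \<Rightarrow> nat \<Rightarrow> nat \<Rightarrow> (nat \<Rightarrow> 'k) \<Rightarrow>
     (nat \<Rightarrow> 'l::euclidean_space) \<Rightarrow> (nat \<Rightarrow> 'k) \<Rightarrow> (nat \<Rightarrow> real) \<Rightarrow> (nat \<Rightarrow> real) \<Rightarrow>
     'l \<Rightarrow> real \<Rightarrow> (nat \<Rightarrow> real) \<Rightarrow> bool" where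
  "LA_constraints \<epsilon> \<theta> nrm N P \<xi> a b d \<kappa> x s r \<longleftrightarrow>
     s \<ge> 0 \<and> (\<forall>i\<in>{1..N}. r i \<ge> 0) \<and>
     \<epsilon> * real N * s - (\<Sum>i\<in>{1..N}. r i) \<ge> \<theta> * real N \<and>
     (\<forall>i\<in>{1..N}. \<forall>p\<in>{1..P}.
        \<kappa> i * ((b p \<bullet> \<xi> i + d p - a p \<bullet> x) / dual_norm nrm (b p)) \<ge> s - r i)"

definition X_LA ::
    "'l::euclidean_space set \<Rightarrow> real \<Rightarrow> real \<Rightarrow> ('k::euclidean_space \<Rightarrow> real) \<Rightarrow> nat \<Rightarrow> nat \<Rightarrow>
     (nat \<Rightarrow> 'k) \<Rightarrow> (nat \<Rightarrow> 'l) \<Rightarrow> (nat \<Rightarrow> 'k) \<Rightarrow> (nat \<Rightarrow> real) \<Rightarrow> (nat \<Rightarrow> real) \<Rightarrow>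
     'l set" where
  "X_LA X \<epsilon> \<theta> nrm N P \<xi> a b d \<kappa> =
     {x \<in> X. \<exists>s r. LA_constraints \<epsilon> \<theta> nrm N P \<xi> a b d \<kappa> x s r}"

definition X_SLA ::
    "'l::euclidean_space set \<Rightarrow> real \<Rightarrow> real \<Rightarrow> ('k::euclidean_space \<Rightarrow> real) \<Rightarrow> nat \<Rightarrow> nat \<Rightarrow>
     (nat \<Rightarrow> 'k) \<Rightarrow> (nat \<Rightarrow> 'l) \<Rightarrow> (nat \<Rightarrow> 'k) \<Rightarrow> (nat \<Rightarrow> real) \<Rightarrow> (nat \<Rightarrow> real) \<Rightarrow>
     'l set" where
  "X_SLA X \<epsilon> \<theta> nrm N P \<xi> a b d \<kappa> =
     {x \<in> X. \<exists>s r. LA_constraints \<epsilon> \<theta> nrm N P \<xi> a b d \<kappa> x s r \<and>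
        (\<forall>p\<in>{1..P}.
           (scenario_quantile \<epsilon> N \<xi> (b p) + d p - a p \<bullet> x) / dual_norm nrm (b p) \<ge> s)}"

end

theory Submission
  imports Defs
begin

text \<open>
  The quantile constraint never cuts off a point, because a pair \<open>(s, r)\<close> that violates it can be
  repaired. For a fixed \<open>x\<close> let \<open>t\<close> be the smallest, over \<open>p\<close>, of the normalised quantile margins,
  attained at \<open>p\<^sub>0\<close>, and suppose that \<open>s > t\<close>. Replace \<open>s\<close> by \<open>t\<close> and each \<open>r i\<close> by
  \<open>max 0 (r i - (s - t))\<close>, so that \<open>s\<close> and every \<open>r i\<close> drop by \<open>s - t\<close>, as far as
  \<open>r i \<ge> 0\<close> allows. The difference \<open>s - r i\<close> does not change, unless it exceeded \<open>t\<close> and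
  becomes \<open>t\<close>; in both cases the linear constraints survive.

  The budget constraint is where the quantile enters. At least \<open>\<lfloor>\<epsilon>N\<rfloor> + 1\<close> samples have a margin
  at most \<open>t\<close> for \<open>p\<^sub>0\<close> (lemma \<open>quantile_count\<close>). If \<open>t \<ge> 0\<close>, then \<open>\<kappa> i \<le> 1\<close> forces
  \<open>s - r i \<le> t\<close> for these samples, so each of their \<open>r i\<close> drops by the full \<open>s - t\<close>, and the sum of
  the \<open>r i\<close> loses at least the amount \<open>\<epsilon>N(s - t)\<close> that \<open>\<epsilon>Ns\<close> loses. If \<open>t < 0\<close>, the same
  samples have \<open>s - r i \<le> 0\<close>, so the sum of the \<open>r i\<close> is at least \<open>\<epsilon>Ns\<close>, which contradicts
  \<open>\<theta> > 0\<close>. Both cases are instances of the counting bound \<open>count_le_sum_min\<close>, and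
  \<open>lower_threshold\<close> carries out the repair.

  The norm matters only through the sign of \<open>dual_norm\<close>: dividing by it must preserve the order
  of the margins.
\<close>

section \<open>Nonnegativity of the dual norm\<close>

lemma is_norm_convex:
  assumes "is_norm nrm"
  shows "convex_on UNIV nrm"
proof (rule convex_onI)
  fix t :: real and x y :: 'a
  assume t: "0 < t" "t < 1"
  have "nrm ((1 - t) *\<^sub>R x + t *\<^sub>R y) \<le> nrm ((1 - t) *\<^sub>R x) + nrm (t *\<^sub>R y)"
    using assms unfolding is_norm_def by blast
  also have "\<dots> = (1 - t) * nrm x + t * nrm y"
    using assms t by (simp add: is_norm_def)
  finally show "nrm ((1 - t) *\<^sub>R x + t *\<^sub>R y) \<le> (1 - t) * nrm x + t * nrm y" .
qed simp

text \<open>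
  A norm is convex, hence continuous in finite dimension, hence bounded away from zero on the
  compact Euclidean unit sphere; scaling gives the bound everywhere.
\<close>

lemma is_norm_dominates_norm:
  fixes nrm :: "'a::euclidean_space \<Rightarrow> real"
  assumes nrm: "is_norm nrm"
  obtains c where "0 < c" and "\<And>x. c * norm x \<le> nrm x"
proof -
  have "continuous_on (sphere 0 1) nrm"
    using convex_on_continuous[OF open_UNIV is_norm_convex[OF nrm]]
    by (rule continuous_on_subset) simp
  moreover have "sphere (0::'a) 1 \<noteq> {}"
    by simp
  ultimately obtain u where u: "u \<in> sphere 0 1" and min: "\<And>v. v \<in> sphere 0 1 \<Longrightarrow> nrm u \<le> nrm v"
    using continuous_attains_inf[OF compact_sphere] by metis
  show thesis
  proof
    have "u \<noteq> 0"
      using u by auto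
    then show "0 < nrm u"
      using nrm unfolding is_norm_def by (metis less_le)
    fix x
    show "nrm u * norm x \<le> nrm x"
    proof (cases "x = 0")
      case True
      then show ?thesis
        using nrm by (simp add: is_norm_def)
    next
      case False
      then have "nrm u \<le> nrm ((1 / norm x) *\<^sub>R x)"
        by (intro min) simp
      also have "\<dots> = nrm x / norm x"
        using nrm by (simp add: is_norm_def)
      finally show ?thesis
        using False by (simp add: field_simps)
    qed
  qed
qed

text \<open>
  The value at \<open>0\<close> shows that the supremum is nonnegative once the unit ball is known to be bounded;
  for an unbounded set of reals the supremum is unspecified.
\<close>

lemma dual_norm_nonneg:
  fixes nrm :: "'a::euclidean_space \<Rightarrow> real"
  assumes nrm: "is_norm nrm"
  shows "0 \<le> dual_norm nrm y"
proof -
  obtain c where c: "0 < c" "\<And>x. c * norm x \<le> nrm x"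
    using is_norm_dominates_norm[OF nrm] by blast
  have "y \<bullet> x \<le> norm y * (1 / c)" if "nrm x \<le> 1" for x
  proof -
    have "norm x \<le> 1 / c"
      using c(1) c(2)[of x] that by (simp add: field_simps)
    then have "norm y * norm x \<le> norm y * (1 / c)"
      by (intro mult_left_mono) auto
    then show ?thesis
      using norm_cauchy_schwarz[of y x] by linarith
  qed
  then have "bdd_above ((\<lambda>x. y \<bullet> x) ` {x. nrm x \<le> 1})"
    by (intro bdd_aboveI2) auto
  moreover have "nrm 0 = 0"
    using nrm unfolding is_norm_def by blast
  then have "0 \<in> {x. nrm x \<le> 1}"
    by simp
  ultimately have "y \<bullet> 0 \<le> dual_norm nrm y"
    unfolding dual_norm_def by (rule cSUP_upper[rotated])
  then show ?thesis
    by simp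
qed

section \<open>Counting samples below a quantile\<close>

lemma length_filter_le_sort_nth:
  fixes xs :: "'a::linorder list"
  assumes "k < length xs"
  shows "k < length (filter (\<lambda>x. x \<le> sort xs ! k) xs)"
proof -
  have "mset (filter (\<lambda>x. x \<le> sort xs ! k) xs) = mset (filter (\<lambda>x. x \<le> sort xs ! k) (sort xs))"
    by simp
  then have "length (filter (\<lambda>x. x \<le> sort xs ! k) xs)
      = length (filter (\<lambda>x. x \<le> sort xs ! k) (sort xs))"
    by (rule mset_eq_length)
  then have "length (filter (\<lambda>x. x \<le> sort xs ! k) xs)
      = card {i. i < length xs \<and> sort xs ! i \<le> sort xs ! k}"
    by (simp add: length_filter_conv_card)
  moreover have "{..k} \<subseteq> {i. i < length xs \<and> sort xs ! i \<le> sort xs ! k}"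
    using assms by (auto intro: sorted_nth_mono)
  then have "card {..k} \<le> card {i. i < length xs \<and> sort xs ! i \<le> sort xs ! k}"
    by (intro card_mono) auto
  ultimately show ?thesis
    by simp
qed

lemma quantile_count:
  assumes "0 \<le> \<epsilon>" and "\<epsilon> < 1" and "0 < N"
  shows "\<epsilon> * real N \<le> real (card {i\<in>{1..N}. v \<bullet> \<xi> i \<le> scenario_quantile \<epsilon> N \<xi> v})"
proof -
  define k where "k = nat \<lfloor>\<epsilon> * real N\<rfloor>"
  define f where "f = (\<lambda>i. v \<bullet> \<xi> i)"
  have "\<epsilon> * real N < real N"
    using assms by simp
  moreover have "0 \<le> \<epsilon> * real N"
    using assms by simp
  ultimately have k: "k < N" "\<epsilon> * real N \<le> real (Suc k)"
    unfolding k_def by linarith+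
  have "k < length (filter (\<lambda>x. x \<le> sort (map f [1..<N+1]) ! k) (map f [1..<N+1]))"
    using k by (intro length_filter_le_sort_nth) simp
  also have "\<dots> = length (filter (\<lambda>i. f i \<le> sort (map f [1..<N+1]) ! k) [1..<N+1])"
    by (simp add: filter_map o_def del: upt_Suc)
  also have "\<dots> = card ({i. f i \<le> sort (map f [1..<N+1]) ! k} \<inter> set [1..<N+1])"
    by (rule distinct_length_filter) simp
  also have "{i. f i \<le> sort (map f [1..<N+1]) ! k} \<inter> set [1..<N+1]
      = {i\<in>{1..N}. v \<bullet> \<xi> i \<le> scenario_quantile \<epsilon> N \<xi> v}"
    by (auto simp: scenario_quantile_def f_def k_def simp del: upt_Suc)
  finally show ?thesis
    using k(2) by linarith
qed

section \<open>Lowering the threshold\<close>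

lemma count_le_sum_min:
  fixes r :: "'i \<Rightarrow> real"
  assumes "finite I" and "J \<subseteq> I" and "c \<le> real (card J)" and "0 \<le> \<delta>"
    and "\<And>i. i \<in> I \<Longrightarrow> 0 \<le> r i" and "\<And>i. i \<in> J \<Longrightarrow> \<delta> \<le> r i"
  shows "c * \<delta> \<le> (\<Sum>i\<in>I. min (r i) \<delta>)"
proof -
  have "c * \<delta> \<le> real (card J) * \<delta>"
    using assms by (intro mult_right_mono)
  also have "\<dots> = (\<Sum>i\<in>J. min (r i) \<delta>)"
    using assms by (simp add: min_absorb2)
  also have "\<dots> \<le> (\<Sum>i\<in>I. min (r i) \<delta>)"
    using assms by (intro sum_mono2) auto
  finally show ?thesis .
qed

text \<open>
  Here \<open>c\<close> is \<open>\<epsilon>N\<close>, \<open>u i p\<close> is the margin of sample \<open>i\<close> for the constraint \<open>p\<close>, and \<open>p\<^sub>0\<close> is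
  the constraint with the smallest quantile margin \<open>t\<close>. Only the margins for \<open>p\<^sub>0\<close> enter
  the budget, while the slope constraints are kept for every \<open>p\<close>.
\<close>

lemma lower_threshold:
  fixes u :: "'i \<Rightarrow> 'p \<Rightarrow> real" and r \<kappa> :: "'i \<Rightarrow> real"
  assumes "finite I" and "p\<^sub>0 \<in> A"
    and \<kappa>: "\<And>i. i \<in> I \<Longrightarrow> 0 \<le> \<kappa> i \<and> \<kappa> i \<le> 1"
    and "0 < \<beta>" and "0 \<le> s"
    and r: "\<And>i. i \<in> I \<Longrightarrow> 0 \<le> r i"
    and budget: "\<beta> \<le> c * s - (\<Sum>i\<in>I. r i)"
    and slope: "\<And>i p. i \<in> I \<Longrightarrow> p \<in> A \<Longrightarrow> s - r i \<le> \<kappa> i * u i p"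
    and count: "c \<le> real (card {i\<in>I. u i p\<^sub>0 \<le> t})"
    and "t < s"
  shows "0 \<le> t \<and> (\<exists>r'. (\<forall>i\<in>I. 0 \<le> r' i) \<and> \<beta> \<le> c * t - (\<Sum>i\<in>I. r' i) \<and>
    (\<forall>i\<in>I. \<forall>p\<in>A. t - r' i \<le> \<kappa> i * u i p))"
proof -
  define J where "J = {i\<in>I. u i p\<^sub>0 \<le> t}"
  have J: "s - r i \<le> max 0 t" if "i \<in> J" for i
  proof -
    have i: "i \<in> I" "u i p\<^sub>0 \<le> t"
      using that by (auto simp: J_def)
    have "\<kappa> i * u i p\<^sub>0 \<le> \<kappa> i * max 0 t"
      using \<kappa>[OF i(1)] i(2) by (intro mult_left_mono) auto
    also have "\<dots> \<le> max 0 t"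
      using \<kappa>[OF i(1)] by (intro mult_left_le_one_le) auto
    finally show ?thesis
      using slope[OF i(1) \<open>p\<^sub>0 \<in> A\<close>] by linarith
  qed
  have count_bound: "c * \<delta> \<le> (\<Sum>i\<in>I. min (r i) \<delta>)"
    if "0 \<le> \<delta>" "\<And>i. i \<in> J \<Longrightarrow> \<delta> \<le> r i" for \<delta>
    using that r count \<open>finite I\<close> by (intro count_le_sum_min[where J = J]) (auto simp: J_def)
  have "0 \<le> t"
  proof (rule ccontr)
    assume "\<not> 0 \<le> t"
    then have "s \<le> r i" if "i \<in> J" for i
      using J[OF that] by simp
    then have "c * s \<le> (\<Sum>i\<in>I. min (r i) s)"
      using \<open>0 \<le> s\<close> by (intro count_bound)
    also have "\<dots> \<le> (\<Sum>i\<in>I. r i)"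
      by (intro sum_mono) simp
    finally show False
      using budget \<open>0 < \<beta>\<close> by linarith
  qed
  \<comment> \<open>This is \<open>max 0 (r i - (s - t))\<close>, written so that the decrease is the term bounded by counting.\<close>
  define r' where "r' i = r i - min (r i) (s - t)" for i
  have "s - t \<le> r i" if "i \<in> J" for i
    using J[OF that] \<open>0 \<le> t\<close> by simp
  then have "c * (s - t) \<le> (\<Sum>i\<in>I. min (r i) (s - t))"
    using \<open>t < s\<close> by (intro count_bound) auto
  then have "\<beta> \<le> c * t - (\<Sum>i\<in>I. r' i)"
    using budget by (simp add: r'_def sum_subtractf right_diff_distrib)
  moreover have "t - r' i \<le> \<kappa> i * u i p" if "i \<in> I" "p \<in> A" for i p
  proof -
    have "t - r' i = min t (s - r i)"
      by (simp add: r'_def min_def)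
    then show ?thesis
      using slope[OF that] by simp
  qed
  moreover have "0 \<le> r' i" for i
    by (simp add: r'_def)
  ultimately show ?thesis
    using \<open>0 \<le> t\<close> by blast
qed

section \<open>The two feasible sets coincide\<close>

theorem proposition1:
  fixes X :: "(real ^ 'l) set"
    and \<epsilon> \<theta> :: real
    and nrm :: "real ^ 'k \<Rightarrow> real"
    and N P :: nat
    and \<xi> :: "nat \<Rightarrow> real ^ 'k"
    and a :: "nat \<Rightarrow> real ^ 'l"
    and b :: "nat \<Rightarrow> real ^ 'k"
    and d \<kappa> :: "nat \<Rightarrow> real"
  assumes "polyhedron X" and "compact X"
    and "0 < \<epsilon>" and "\<epsilon> < 1"
    and "0 < \<theta>"
    and "is_norm nrm"
    and "0 < N" and "0 < P"
    and "\<And>p. p \<in> {1..P} \<Longrightarrow> b p \<noteq> 0"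
    and "\<And>i. i \<in> {1..N} \<Longrightarrow> \<kappa> i \<in> {0..1}"
  shows "X_LA X \<epsilon> \<theta> nrm N P \<xi> a b d \<kappa> = X_SLA X \<epsilon> \<theta> nrm N P \<xi> a b d \<kappa>"
proof
  show "X_SLA X \<epsilon> \<theta> nrm N P \<xi> a b d \<kappa> \<subseteq> X_LA X \<epsilon> \<theta> nrm N P \<xi> a b d \<kappa>"
    by (auto simp: X_LA_def X_SLA_def)
next
  show "X_LA X \<epsilon> \<theta> nrm N P \<xi> a b d \<kappa> \<subseteq> X_SLA X \<epsilon> \<theta> nrm N P \<xi> a b d \<kappa>"
  proof
    fix x
    assume "x \<in> X_LA X \<epsilon> \<theta> nrm N P \<xi> a b d \<kappa>"
    then obtain s r where "x \<in> X" and LA: "LA_constraints \<epsilon> \<theta> nrm N P \<xi> a b d \<kappa> x s r"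
      by (auto simp: X_LA_def)
    define margin where "margin p v = (v + d p - a p \<bullet> x) / dual_norm nrm (b p)" for p v
    define q where "q p = margin p (scenario_quantile \<epsilon> N \<xi> (b p))" for p
    have LA_iff: "LA_constraints \<epsilon> \<theta> nrm N P \<xi> a b d \<kappa> x s' r' \<longleftrightarrow>
        0 \<le> s' \<and> (\<forall>i\<in>{1..N}. 0 \<le> r' i) \<and>
        \<theta> * real N \<le> \<epsilon> * real N * s' - (\<Sum>i\<in>{1..N}. r' i) \<and>
        (\<forall>i\<in>{1..N}. \<forall>p\<in>{1..P}. s' - r' i \<le> \<kappa> i * margin p (b p \<bullet> \<xi> i))" for s' r'
      by (simp add: LA_constraints_def margin_def)
    have "\<exists>p\<^sub>0. is_arg_min q (\<lambda>p. p \<in> {1..P}) p\<^sub>0"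
      using \<open>0 < P\<close> by (intro ex_is_arg_min_if_finite) auto
    then obtain p\<^sub>0 where p\<^sub>0: "p\<^sub>0 \<in> {1..P}" "\<And>p. p \<in> {1..P} \<Longrightarrow> q p\<^sub>0 \<le> q p"
      by (auto simp: is_arg_min_linorder)
    have "\<exists>s' r'. LA_constraints \<epsilon> \<theta> nrm N P \<xi> a b d \<kappa> x s' r' \<and> s' \<le> q p\<^sub>0"
    proof (cases "s \<le> q p\<^sub>0")
      case True
      then show ?thesis
        using LA by blast
    next
      case False
      have "margin p\<^sub>0 (b p\<^sub>0 \<bullet> \<xi> i) \<le> q p\<^sub>0"
        if "b p\<^sub>0 \<bullet> \<xi> i \<le> scenario_quantile \<epsilon> N \<xi> (b p\<^sub>0)" for i
        unfolding q_def margin_def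
        using that dual_norm_nonneg[OF \<open>is_norm nrm\<close>] by (intro divide_right_mono) auto
      then have "card {i\<in>{1..N}. b p\<^sub>0 \<bullet> \<xi> i \<le> scenario_quantile \<epsilon> N \<xi> (b p\<^sub>0)}
          \<le> card {i\<in>{1..N}. margin p\<^sub>0 (b p\<^sub>0 \<bullet> \<xi> i) \<le> q p\<^sub>0}"
        by (intro card_mono) auto
      moreover have "\<epsilon> * real N
          \<le> real (card {i\<in>{1..N}. b p\<^sub>0 \<bullet> \<xi> i \<le> scenario_quantile \<epsilon> N \<xi> (b p\<^sub>0)})"
        using assms by (intro quantile_count) auto
      ultimately have count:
        "\<epsilon> * real N \<le> real (card {i\<in>{1..N}. margin p\<^sub>0 (b p\<^sub>0 \<bullet> \<xi> i) \<le> q p\<^sub>0})"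
        by linarith
      have "0 \<le> q p\<^sub>0 \<and> (\<exists>r'. (\<forall>i\<in>{1..N}. 0 \<le> r' i) \<and>
          \<theta> * real N \<le> \<epsilon> * real N * q p\<^sub>0 - (\<Sum>i\<in>{1..N}. r' i) \<and>
          (\<forall>i\<in>{1..N}. \<forall>p\<in>{1..P}. q p\<^sub>0 - r' i \<le> \<kappa> i * margin p (b p \<bullet> \<xi> i)))"
      proof (rule lower_threshold)
        show "0 \<le> \<kappa> i \<and> \<kappa> i \<le> 1" if "i \<in> {1..N}" for i
          using assms(10)[OF that] by simp
        show "0 < \<theta> * real N"
          using \<open>0 < \<theta>\<close> \<open>0 < N\<close> by simp
        show "q p\<^sub>0 < s"
          using False by simp
        show "\<theta> * real N \<le> \<epsilon> * real N * s - (\<Sum>i\<in>{1..N}. r i)"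
          using LA LA_iff by blast
      qed (use LA LA_iff p\<^sub>0(1) count in blast)+
      then show ?thesis
        unfolding LA_iff by blast
    qed
    then obtain s' r' where "LA_constraints \<epsilon> \<theta> nrm N P \<xi> a b d \<kappa> x s' r'" and "s' \<le> q p\<^sub>0"
      by blast
    moreover from \<open>s' \<le> q p\<^sub>0\<close> have "s' \<le> q p" if "p \<in> {1..P}" for p
      using p\<^sub>0(2)[OF that] by linarith
    ultimately show "x \<in> X_SLA X \<epsilon> \<theta> nrm N P \<xi> a b d \<kappa>"
      using \<open>x \<in> X\<close> unfolding X_SLA_def q_def margin_def by blast
  qed
qed

end
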